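(* Let all variables follow a linear non-Gaussian acyclic causal model, let $Y$ be a single variable and $\mathbf{Z}$ a set of variables of the model (all observed), and let $\ddot{Y} := (Y,\mathbf{Z})$. Then: 1. If $(\mathbf{Z},\ddot{Y})$ follows the GIN condition, then $(\mathbf{Z},Y)$ follows the IN condition. 2. If $(\mathbf{Z},Y)$ follows the IN condition, then $(\mathbf{Z},\ddot{Y})$ follows the GIN condition.
   Context: Linear non-Gaussian acyclic causal model: a finite set of zero-mean random variables $\mathbf{V}=\{V_1,\dots,V_n\}$ with a directed acyclic graph on $\mathbf V$ such that $V_i=\sum_{V_j\in \mathbf{Pa}(V_i)} b_{ij}V_j+\varepsilon_{V_i}$, where the noises $\varepsilon_{V_1},\dots,\varepsilon_{V_n}$ are mutually independent continuous random variables, each non-Gaussian with non-zero (finite) variance. IN (Independent Noise) condition: for a single variable $Y$ and a set (vector) of variables $\mathbf{Z}$, let $\tilde E_{Y||\mathbf{Z}} = Y-\tilde\omega^\intercal\mathbf{Z}$ be the residual of linearly regressing $Y$ on $\mathbf{Z}$, with coefficient vector given by $\mathbb{E}[Y\mathbf{Z}^\intercal]\,\mathbb{E}^{-1}[\mathbf{Z}\mathbf{Z}^\intercal]$. $(\mathbf{Z},Y)$ follows the IN condition if and only if $\tilde E_{Y||\mathbf{Z}}$ is independent of $\mathbf{Z}$. GIN (Generalized Independent Noise) condition: for random vectors $\mathbf{Y},\mathbf{Z}$ of variables of such a model, the surrogate variable of $\mathbf{Y}$ relative to $\mathbf{Z}$ is $E_{\mathbf{Y}||\mathbf{Z}}:=\omega^\intercal\mathbf{Y}$,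 where $\omega$ satisfies $\omega^\intercal\mathbb{E}[\mathbf{Y}\mathbf{Z}^\intercal]=\mathbf 0$ and $\omega\neq\mathbf 0$. $(\mathbf{Z},\mathbf{Y})$ follows the GIN condition if and only if $E_{\mathbf{Y}||\mathbf{Z}}$ is independent of $\mathbf{Z}$; that is, at least one such $\omega$ exists, and $\omega^\intercal\mathbf{Y}$ is statistically independent of $\mathbf{Z}$ for every such $\omega$. *)

theory Defs
  imports "HOL-Probability.Probability"
begin

definition gaussian :: "'a measure \<Rightarrow> ('a \<Rightarrow> real) \<Rightarrow> bool" where
  "gaussian M X \<longleftrightarrow> (\<exists>\<mu> \<sigma>. \<sigma> > 0 \<and> distributed M lborel X (\<lambda>x. ennreal (normal_density \<mu> \<sigma> x)))"

text \<open>
  An edge \<open>(j, i) \<in> G\<close> means that \<open>V j\<close> is a parent of \<open>V i\<close>. The structural equations are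
  equations between random variables and hence hold almost surely. Continuous means having
  a density with respect to Lebesgue measure. Degenerate normal distributions need not be
  counted as Gaussian, since the variance of the noise is non-zero.
\<close>

locale lingam = prob_space M
  for M :: "'a measure" +
  fixes V :: "'n::finite \<Rightarrow> 'a \<Rightarrow> real"
    and G :: "('n \<times> 'n) set"
    and b :: "'n \<Rightarrow> 'n \<Rightarrow> real"
    and noise :: "'n \<Rightarrow> 'a \<Rightarrow> real"
  assumes integrable_V: "\<And>i. integrable M (V i)"
    and zero_mean: "\<And>i. expectation (V i) = 0"
    and acyclic_G: "acyclic G"
    and structural: "\<And>i. AE x in M. V i x = (\<Sum>j | (j, i) \<in> G. b i j * V j x) + noise i x"
    and indep_noise: "indep_vars (\<lambda>_. borel) noise UNIV"
    and continuous_noise: "\<And>i. \<exists>f. distributed M lborel (noise i) f"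
    and non_gaussian: "\<And>i. \<not> gaussian M (noise i)"
    and finite_variance: "\<And>i. integrable M (\<lambda>x. (noise i x)\<^sup>2)"
    and nonzero_variance: "\<And>i. variance (noise i) \<noteq> 0"

text \<open>
  The library's \<open>prob_space.indep_var\<close> forces both random variables to take values in the
  same type; here a scalar has to be independent of a vector.
\<close>

definition indep_rv ::
  "'a measure \<Rightarrow> ('a \<Rightarrow> 'b::topological_space) \<Rightarrow> ('a \<Rightarrow> 'c::topological_space) \<Rightarrow> bool" where
  "indep_rv M X Y \<longleftrightarrow> X \<in> borel_measurable M \<and> Y \<in> borel_measurable M \<and>
     prob_space.indep_set M {X -` A \<inter> space M | A. A \<in> sets borel} {Y -` B \<inter> space M | B. B \<in> sets borel}"

lemma (in prob_space) indep_rv_iff_indep_var: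
  fixes X Y :: "'a \<Rightarrow> 'b::topological_space"
  shows "indep_rv M X Y \<longleftrightarrow> indep_var borel X borel Y"
proof -
  have "sigma_sets (space M) {Z -` A \<inter> space M | A. A \<in> sets borel} =
      {Z -` A \<inter> space M | A. A \<in> sets borel}" for Z :: "'a \<Rightarrow> 'b"
    using sets_vimage_algebra[of "space M" Z borel] sets_vimage_algebra2[of Z "space M" borel] by simp
  then show ?thesis
    unfolding indep_rv_def indep_var_eq by simp
qed

text \<open>The matrix \<open>E[Y Z\<^sup>T]\<close>.\<close>

definition cross_moment :: "'a measure \<Rightarrow> ('a \<Rightarrow> real^'p) \<Rightarrow> ('a \<Rightarrow> real^'q) \<Rightarrow> real^'q^'p" where
  "cross_moment M Y Z = (\<chi> i j. \<integral>x. Y x $ i * Z x $ j \<partial>M)"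

text \<open>
  The row vector \<open>E[Y Z\<^sup>T] E[Z Z\<^sup>T]\<^sup>-\<^sup>1\<close> for a single variable \<open>Y\<close>; it is meaningful
  only if \<open>E[Z Z\<^sup>T]\<close> is invertible, which holds for distinct variables of a \<open>lingam\<close>.
\<close>

definition regression_coeff :: "'a measure \<Rightarrow> ('a \<Rightarrow> real) \<Rightarrow> ('a \<Rightarrow> real^'q) \<Rightarrow> real^'q" where
  "regression_coeff M Y Z =
     (\<chi> j. \<integral>x. Y x * Z x $ j \<partial>M) v* matrix_inv (cross_moment M Z Z)"

definition residual :: "'a measure \<Rightarrow> ('a \<Rightarrow> real) \<Rightarrow> ('a \<Rightarrow> real^'q) \<Rightarrow> 'a \<Rightarrow> real" where
  "residual M Y Z = (\<lambda>x. Y x - regression_coeff M Y Z \<bullet> Z x)"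

definition IN_condition :: "'a measure \<Rightarrow> ('a \<Rightarrow> real^'q) \<Rightarrow> ('a \<Rightarrow> real) \<Rightarrow> bool" where
  "IN_condition M Z Y \<longleftrightarrow> indep_rv M (residual M Y Z) Z"

definition surrogate_coeffs :: "'a measure \<Rightarrow> ('a \<Rightarrow> real^'p) \<Rightarrow> ('a \<Rightarrow> real^'q) \<Rightarrow> (real^'p) set" where
  "surrogate_coeffs M Y Z = {w. w v* cross_moment M Y Z = 0 \<and> w \<noteq> 0}"

definition GIN_condition :: "'a measure \<Rightarrow> ('a \<Rightarrow> real^'q) \<Rightarrow> ('a \<Rightarrow> real^'p) \<Rightarrow> bool" where
  "GIN_condition M Z Y \<longleftrightarrow> surrogate_coeffs M Y Z \<noteq> {} \<and>
     (\<forall>w \<in> surrogate_coeffs M Y Z. indep_rv M (\<lambda>x. w \<bullet> Y x) Z)"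

definition subvector :: "('n \<Rightarrow> 'a \<Rightarrow> real) \<Rightarrow> ('q::finite \<Rightarrow> 'n) \<Rightarrow> 'a \<Rightarrow> real^'q" where
  "subvector V s = (\<lambda>x. \<chi> k. V (s k) x)"

text \<open>The vector \<open>(Y, Z)\<close>, where the index \<open>None\<close> belongs to the entry \<open>Y\<close>.\<close>

definition prepend :: "('a \<Rightarrow> real) \<Rightarrow> ('a \<Rightarrow> real^'q) \<Rightarrow> 'a \<Rightarrow> real^('q option)" where
  "prepend Y Z = (\<lambda>x. \<chi> k. case k of None \<Rightarrow> Y x | Some j \<Rightarrow> Z x $ j)"

end

theory Submission
  imports Defs
begin

text \<open>
  The residual of regressing \<open>Y\<close> on \<open>Z\<close> is the surrogate variable of \<open>(Y, Z)\<close> with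
  coefficients \<open>(1, -\<omega>)\<close>, and as soon as \<open>E[Z Z\<^sup>T]\<close> is invertible, every coefficient
  vector \<open>(a, v)\<close> annihilating \<open>E[(Y, Z) Z\<^sup>T]\<close> is the multiple \<open>a (1, -\<omega>)\<close> of it. Invertibility
  is linear independence of the variables in \<open>L\<^sup>2\<close>: in a vanishing combination, take a
  variable with non-zero coefficient none of whose proper descendants occurs. Its noise is
  orthogonal to all other variables that occur, but not to the variable itself.
\<close>

text \<open>Every event determined by \<open>f (X x)\<close> is one determined by \<open>X\<close>,
  so the family on the left only shrinks. The use below is for scalar multiples of the
  residual.\<close>

lemma (in prob_space) indep_rv_compose:
  assumes "indep_rv M X Z" and "f \<in> borel_measurable borel"
  shows "indep_rv M (\<lambda>x. f (X x)) Z"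
proof -
  have X: "X \<in> borel_measurable M"
    using assms(1) unfolding indep_rv_def by blast
  have "\<exists>B. (\<lambda>x. f (X x)) -` A \<inter> space M = X -` B \<inter> space M \<and> B \<in> sets borel"
    if "A \<in> sets borel" for A
    using measurable_sets[OF assms(2) that] by (intro exI[of _ "f -` A"]) auto
  then have sub: "{(\<lambda>x. f (X x)) -` A \<inter> space M | A. A \<in> sets borel} \<subseteq>
      {X -` A \<inter> space M | A. A \<in> sets borel}"
    by blast
  have mono: "indep_set \<A>' \<B>" if "indep_set \<A> \<B>" "\<A>' \<subseteq> \<A>" for \<A> \<A>' \<B>
    using that unfolding indep_sets2_eq by blast
  show ?thesis
    using assms(1) mono[OF _ sub] measurable_compose[OF X assms(2)]
    unfolding indep_rv_def by blast
qed

section \<open>Square integrability and the second moment matrix\<close>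

lemma integrable_mult_of_squares:
  fixes f g :: "'a \<Rightarrow> real"
  assumes [measurable]: "f \<in> borel_measurable M" "g \<in> borel_measurable M"
    and "integrable M (\<lambda>x. (f x)\<^sup>2)" "integrable M (\<lambda>x. (g x)\<^sup>2)"
  shows "integrable M (\<lambda>x. f x * g x)"
proof (rule Bochner_Integration.integrable_bound)
  show "integrable M (\<lambda>x. (f x)\<^sup>2 + (g x)\<^sup>2)"
    using assms by simp
  have "\<bar>u * v\<bar> \<le> u\<^sup>2 + v\<^sup>2" for u v :: real
  proof -
    have "2 * (\<bar>u\<bar> * \<bar>v\<bar>) \<le> u\<^sup>2 + v\<^sup>2"
      using sum_squares_bound[of "\<bar>u\<bar>" "\<bar>v\<bar>"] by simp
    moreover have "0 \<le> \<bar>u\<bar> * \<bar>v\<bar>"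
      by simp
    ultimately show ?thesis
      unfolding abs_mult by linarith
  qed
  then show "AE x in M. norm (f x * g x) \<le> norm ((f x)\<^sup>2 + (g x)\<^sup>2)"
    by simp
qed simp

lemma integrable_square_add:
  fixes f g :: "'a \<Rightarrow> real"
  assumes "f \<in> borel_measurable M" "g \<in> borel_measurable M"
    and "integrable M (\<lambda>x. (f x)\<^sup>2)" "integrable M (\<lambda>x. (g x)\<^sup>2)"
  shows "integrable M (\<lambda>x. (f x + g x)\<^sup>2)"
  using assms integrable_mult_of_squares[OF assms]
  by (simp add: power2_sum mult.assoc)

lemma integrable_square_sum:
  fixes f :: "'i \<Rightarrow> 'a \<Rightarrow> real"
  assumes "\<And>i. i \<in> I \<Longrightarrow> f i \<in> borel_measurable M"
    and "\<And>i. i \<in> I \<Longrightarrow> integrable M (\<lambda>x. (f i x)\<^sup>2)"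
  shows "integrable M (\<lambda>x. (\<Sum>i\<in>I. f i x)\<^sup>2)"
  using assms
proof (induction I rule: infinite_finite_induct)
  case (insert i I)
  then show ?case
    using integrable_square_add[of "f i" M "\<lambda>x. \<Sum>i\<in>I. f i x"] by simp
qed simp_all

text \<open>The quadratic form of the moment matrix at \<open>c\<close> is the second moment of
  \<open>c \<bullet> Z x\<close>, so a kernel vector gives a combination that vanishes almost
  everywhere.\<close>

lemma invertible_cross_moment:
  fixes Z :: "'a \<Rightarrow> real^'q"
  assumes int: "\<And>i j. integrable M (\<lambda>x. Z x $ i * Z x $ j)"
    and indep: "\<And>c. AE x in M. c \<bullet> Z x = 0 \<Longrightarrow> c = 0"
  shows "invertible (cross_moment M Z Z)"
proof -
  have "c = 0" if "cross_moment M Z Z *v c = 0" for c :: "real^'q"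
  proof (rule indep)
    have sq: "(c \<bullet> Z x)\<^sup>2 = (\<Sum>i\<in>UNIV. \<Sum>j\<in>UNIV. c $ i * c $ j * (Z x $ i * Z x $ j))" for x
      by (simp add: inner_vec_def power2_eq_square sum_product mult_ac)
    have "(\<integral>x. (c \<bullet> Z x)\<^sup>2 \<partial>M) =
        (\<Sum>i\<in>UNIV. \<Sum>j\<in>UNIV. c $ i * c $ j * (\<integral>x. Z x $ i * Z x $ j \<partial>M))"
      unfolding sq by (simp add: int)
    also have "\<dots> = c \<bullet> (cross_moment M Z Z *v c)"
      by (simp add: cross_moment_def matrix_vector_mult_def inner_vec_def sum_distrib_left mult_ac)
    finally have "(\<integral>x. (c \<bullet> Z x)\<^sup>2 \<partial>M) = 0"
      using that by simp
    moreover have "integrable M (\<lambda>x. (c \<bullet> Z x)\<^sup>2)"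
      unfolding sq by (simp add: int)
    ultimately show "AE x in M. c \<bullet> Z x = 0"
      by (simp add: integral_nonneg_eq_0_iff_AE)
  qed
  then show ?thesis
    by (simp add: invertible_left_inverse matrix_left_invertible_ker)
qed

section \<open>Second moments and linear independence in the causal model\<close>

context lingam
begin

text \<open>There are finitely many nodes, so acyclicity gives induction from parents to
  children.\<close>

lemma wf_G: "wf G"
  using acyclic_G by (simp add: finite_acyclic_wf)

lemma measurable_V [measurable]: "V i \<in> borel_measurable M"
  using integrable_V by (rule borel_measurable_integrable)

lemma measurable_noise [measurable]: "noise i \<in> borel_measurable M"
  using continuous_noise[of i] by (auto simp: distributed_def)

lemma integrable_noise: "integrable M (noise i)"
  using finite_variance measurable_noise by (rule square_integrable_imp_integrable[rotated])

text \<open>Only the variables are assumed centred; taking expectations in the structural equation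
  passes this on to the noise.\<close>

lemma expectation_noise: "expectation (noise i) = 0"
proof -
  have "expectation (V i) = (\<integral>x. (\<Sum>j | (j, i) \<in> G. b i j * V j x) + noise i x \<partial>M)"
    using structural by (intro integral_cong_AE) simp_all
  also have "\<dots> = expectation (noise i)"
    by (simp add: integrable_V integrable_noise zero_mean)
  finally show ?thesis
    by (simp add: zero_mean)
qed

lemma integrable_square_V: "integrable M (\<lambda>x. (V i x)\<^sup>2)"
proof (induction i rule: wf_induct_rule[OF wf_G])
  case (1 i)
  have "integrable M (\<lambda>x. ((\<Sum>j | (j, i) \<in> G. b i j * V j x) + noise i x)\<^sup>2)"
    using 1 finite_variance
    by (intro integrable_square_add integrable_square_sum) (simp_all add: power_mult_distrib)
  then show ?case
    by (rule integrable_cong_AE_imp) (use structural[of i] in \<open>auto elim: eventually_mono\<close>)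
qed

lemma integrable_V_mult_V: "integrable M (\<lambda>x. V i x * V j x)"
  by (intro integrable_mult_of_squares integrable_square_V) simp_all

lemma integrable_noise_mult_V: "integrable M (\<lambda>x. noise i x * V j x)"
  by (intro integrable_mult_of_squares integrable_square_V finite_variance) simp_all

lemma integrable_noise_mult_noise: "integrable M (\<lambda>x. noise i x * noise j x)"
  by (intro integrable_mult_of_squares finite_variance) simp_all

lemma expectation_noise_mult_noise:
  assumes "i \<noteq> j"
  shows "expectation (\<lambda>x. noise i x * noise j x) = 0"
proof -
  have "indep_vars (\<lambda>_. borel) noise {i, j}"
    using indep_noise by (rule indep_vars_subset) simp
  then have "expectation (\<lambda>x. \<Prod>k\<in>{i, j}. noise k x) = (\<Prod>k\<in>{i, j}. expectation (noise k))"
    by (intro indep_vars_lebesgue_integral) (simp_all add: integrable_noise)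
  then show ?thesis
    using assms by (simp add: expectation_noise)
qed

text \<open>Multiplying the structural equation of \<open>V j\<close> by \<open>noise i\<close>
  gives a recursion over the parents of \<open>j\<close>.\<close>

lemma expectation_noise_mult_V:
  "expectation (\<lambda>x. noise i x * V j x) =
     (\<Sum>k | (k, j) \<in> G. b j k * expectation (\<lambda>x. noise i x * V k x)) +
     expectation (\<lambda>x. noise i x * noise j x)"
proof -
  have "expectation (\<lambda>x. noise i x * V j x) =
      (\<integral>x. (\<Sum>k | (k, j) \<in> G. b j k * (noise i x * V k x)) + noise i x * noise j x \<partial>M)"
    using structural[of j]
    by (intro integral_cong_AE)
      (auto elim!: eventually_mono simp: distrib_left sum_distrib_left mult_ac)
  then show ?thesis
    by (simp add: integrable_noise_mult_V integrable_noise_mult_noise)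
qed

text \<open>Parents of a non-descendant of \<open>i\<close> are again non-descendants, so the
  recursion stays at zero. Reflexivity of \<open>G\<^sup>*\<close> excludes \<open>j = i\<close>,
  where the noise term would survive.\<close>

lemma noise_orthogonal_nondescendant:
  assumes "(i, j) \<notin> G\<^sup>*"
  shows "expectation (\<lambda>x. noise i x * V j x) = 0"
  using assms
proof (induction j rule: wf_induct_rule[OF wf_G])
  case (1 j)
  have "expectation (\<lambda>x. noise i x * V k x) = 0" if "(k, j) \<in> G" for k
    using 1 that by (meson rtrancl.rtrancl_into_rtrancl)
  moreover have "i \<noteq> j"
    using 1 by blast
  ultimately show ?case
    by (simp add: expectation_noise_mult_V[of i j] expectation_noise_mult_noise)
qed

text \<open>By acyclicity no parent of \<open>i\<close> descends from \<open>i\<close>, so only the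
  second moment of the noise remains; as its mean is zero, this is the variance.\<close>

lemma expectation_noise_mult_V_same: "expectation (\<lambda>x. noise i x * V i x) = variance (noise i)"
proof -
  have "expectation (\<lambda>x. noise i x * V k x) = 0" if "(k, i) \<in> G" for k
  proof (rule noise_orthogonal_nondescendant)
    show "(i, k) \<notin> G\<^sup>*"
      using that acyclic_G by (meson acyclic_def rtrancl_into_trancl1)
  qed
  then show ?thesis
    by (simp add: expectation_noise_mult_V[of i i] expectation_noise power2_eq_square)
qed

lemma linear_independent_V:
  assumes "AE x in M. (\<Sum>i\<in>UNIV. c i * V i x) = 0"
  shows "c i = 0"
proof (rule ccontr)
  assume "c i \<noteq> 0"
  then have "i \<in> {i. c i \<noteq> 0}"
    by simp
  \<comment> \<open>Minimality for the converse relation looks downstream, and the transitive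
    closure covers all proper descendants of \<open>m\<close>, not just its children.\<close>
  moreover have "wf ((G\<inverse>)\<^sup>+)"
    using acyclic_G by (intro wf_trancl finite_acyclic_wf_converse) simp_all
  ultimately obtain m where "m \<in> {i. c i \<noteq> 0}"
    and min: "\<And>k. (k, m) \<in> (G\<inverse>)\<^sup>+ \<Longrightarrow> k \<notin> {i. c i \<noteq> 0}"
    using wfE_min by metis
  then have m: "c m \<noteq> 0"
    by simp
  \<comment> \<open>For a proper descendant \<open>k\<close> of \<open>m\<close> the coefficient
    vanishes by the choice of \<open>m\<close>; otherwise the expectation does.\<close>
  have zero: "c k * expectation (\<lambda>x. noise m x * V k x) = 0" if "k \<noteq> m" for k
  proof (cases "(m, k) \<in> G\<^sup>*")
    case True
    then have "(m, k) \<in> G\<^sup>+"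
      using that by (metis rtranclD)
    then show ?thesis
      using min[of k] by (simp add: trancl_converse)
  next
    case False
    then show ?thesis
      by (simp add: noise_orthogonal_nondescendant)
  qed
  have "0 = (\<integral>x. (\<Sum>k\<in>UNIV. c k * (noise m x * V k x)) \<partial>M)"
  proof -
    have "(\<Sum>k\<in>UNIV. c k * (noise m x * V k x)) = noise m x * (\<Sum>k\<in>UNIV. c k * V k x)" for x
      by (simp add: sum_distrib_left mult_ac)
    then have "AE x in M. (\<Sum>k\<in>UNIV. c k * (noise m x * V k x)) = 0"
      using assms by (auto elim: eventually_mono)
    then show ?thesis
      by (simp add: integral_eq_zero_AE)
  qed
  also have "\<dots> = (\<Sum>k\<in>UNIV. c k * expectation (\<lambda>x. noise m x * V k x))"
    by (simp add: integrable_noise_mult_V)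
  also have "\<dots> = c m * expectation (\<lambda>x. noise m x * V m x)"
    \<comment> \<open>\<open>mult_eq_0_iff\<close> would split the products into disjunctions, which
      \<open>zero\<close> does not match.\<close>
    by (subst sum.remove[of _ m]) (auto intro!: sum.neutral zero simp del: mult_eq_0_iff)
  also have "\<dots> = c m * variance (noise m)"
    by (simp only: expectation_noise_mult_V_same)
  finally show False
    using m nonzero_variance by simp
qed

lemma invertible_cross_moment_subvector:
  fixes s :: "'q::finite \<Rightarrow> 'n"
  assumes "inj s"
  shows "invertible (cross_moment M (subvector V s) (subvector V s))"
proof (rule invertible_cross_moment)
  show "integrable M (\<lambda>x. subvector V s x $ i * subvector V s x $ j)" for i j
    by (simp add: subvector_def integrable_V_mult_V)
  fix c :: "real^'q"
  assume c: "AE x in M. c \<bullet> subvector V s x = 0"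
  \<comment> \<open>Extension of \<open>c\<close> by zero to all variables; injectivity of
    \<open>s\<close> lets each entry of \<open>c\<close> be recovered from \<open>d\<close>.\<close>
  define d where "d i = (if i \<in> range s then c $ inv s i else 0)" for i
  have d: "d (s k) = c $ k" for k
    using assms by (simp add: d_def)
  have "(\<Sum>i\<in>UNIV. d i * V i x) = c \<bullet> subvector V s x" for x
  proof -
    have "(\<Sum>i\<in>UNIV. d i * V i x) = (\<Sum>i\<in>range s. d i * V i x)"
      by (rule sum.mono_neutral_right) (auto simp: d_def)
    also have "\<dots> = (\<Sum>k\<in>UNIV. c $ k * V (s k) x)"
      by (simp add: sum.reindex[OF assms] d)
    finally show ?thesis
      by (simp add: inner_vec_def subvector_def)
  qed
  then have "d i = 0" for i
    using c by (intro linear_independent_V) simp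
  then show "c = 0"
    using d by (simp add: vec_eq_iff)
qed

end

section \<open>Coefficient vectors for \<open>(Y, Z)\<close> and the two conditions\<close>

lemma sum_UNIV_option:
  fixes f :: "'q::finite option \<Rightarrow> 'b::comm_monoid_add"
  shows "(\<Sum>k\<in>UNIV. f k) = f None + (\<Sum>j\<in>UNIV. f (Some j))"
  by (simp add: UNIV_option_conv sum.reindex)

lemma inner_prepend:
  fixes Z :: "'a \<Rightarrow> real^'q"
  shows "w \<bullet> prepend Y Z x = w $ None * Y x + (\<chi> j. w $ Some j) \<bullet> Z x"
  by (simp add: inner_vec_def prepend_def sum_UNIV_option)

lemma vector_matrix_mult_cross_moment_prepend:
  fixes Z :: "'a \<Rightarrow> real^'q" and W :: "'a \<Rightarrow> real^'p"
  shows "w v* cross_moment M (prepend Y Z) W =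
    w $ None *\<^sub>R (\<chi> j. \<integral>x. Y x * W x $ j \<partial>M) + (\<chi> j. w $ Some j) v* cross_moment M Z W"
  by (simp add: vec_eq_iff vector_matrix_mult_def cross_moment_def prepend_def sum_UNIV_option mult_ac)

lemma surrogate_coeffs_prepend:
  fixes Z :: "'a \<Rightarrow> real^'q"
  assumes "invertible (cross_moment M Z Z)"
  shows "w \<in> surrogate_coeffs M (prepend Y Z) Z \<longleftrightarrow>
    w $ None \<noteq> 0 \<and> (\<chi> j. w $ Some j) = - (w $ None) *\<^sub>R regression_coeff M Y Z"
proof -
  let ?C = "cross_moment M Z Z" and ?v = "\<chi> j. w $ Some j"
  let ?r = "\<chi> j. \<integral>x. Y x * Z x $ j \<partial>M"
  have inv: "?C ** matrix_inv ?C = mat 1" "matrix_inv ?C ** ?C = mat 1"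
    using someI_ex[OF assms[unfolded invertible_def]] unfolding matrix_inv_def by blast+
  have "w $ None *\<^sub>R ?r + ?v v* ?C = 0 \<longleftrightarrow> ?v = - (w $ None) *\<^sub>R (?r v* matrix_inv ?C)"
  proof
    assume "w $ None *\<^sub>R ?r + ?v v* ?C = 0"
    then have "?v v* ?C = (- (w $ None)) *\<^sub>R ?r"
      by (simp add: eq_neg_iff_add_eq_0 add.commute)
    then have "(?v v* ?C) v* matrix_inv ?C = (- (w $ None)) *\<^sub>R (?r v* matrix_inv ?C)"
      by (simp only: scaleR_vector_matrix_assoc)
    then show "?v = - (w $ None) *\<^sub>R (?r v* matrix_inv ?C)"
      by (simp add: vector_matrix_mul_assoc inv)
  next
    assume v: "?v = - (w $ None) *\<^sub>R (?r v* matrix_inv ?C)"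
    have "?v v* ?C = - (w $ None) *\<^sub>R ((?r v* matrix_inv ?C) v* ?C)"
      by (simp only: v scaleR_vector_matrix_assoc)
    then show "w $ None *\<^sub>R ?r + ?v v* ?C = 0"
      by (simp add: vector_matrix_mul_assoc inv)
  qed
  \<comment> \<open>By the equivalence just shown, \<open>w $ None = 0\<close> forces the other
    entries to vanish, so a non-zero solution has a non-zero entry at \<open>None\<close>.\<close>
  moreover have "w = 0 \<longleftrightarrow> w $ None = 0 \<and> ?v = 0"
    by (auto simp: vec_eq_iff) (metis option.exhaust)
  ultimately show ?thesis
    unfolding surrogate_coeffs_def regression_coeff_def
    by (auto simp: vector_matrix_mult_cross_moment_prepend)
qed

lemma (in prob_space) GIN_condition_prepend_iff:
  fixes Z :: "'a \<Rightarrow> real^'q"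
  assumes "invertible (cross_moment M Z Z)"
  shows "GIN_condition M Z (prepend Y Z) \<longleftrightarrow> IN_condition M Z Y"
proof -
  have surrogate: "(\<lambda>x. w \<bullet> prepend Y Z x) = (\<lambda>x. w $ None * residual M Y Z x)"
    if "w \<in> surrogate_coeffs M (prepend Y Z) Z" for w
    using that surrogate_coeffs_prepend[OF assms, of w Y]
    by (simp add: inner_prepend residual_def algebra_simps)
  \<comment> \<open>The coefficients \<open>(1, -\<omega>)\<close>: they show that a surrogate
    exists, and their surrogate variable is the residual itself.\<close>
  define u :: "real^'q option"
    where "u = (\<chi> k. case k of None \<Rightarrow> 1 | Some j \<Rightarrow> - regression_coeff M Y Z $ j)"
  have u: "u \<in> surrogate_coeffs M (prepend Y Z) Z" "u $ None = 1"
    by (simp_all add: surrogate_coeffs_prepend[OF assms] u_def vec_eq_iff)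
  have "indep_rv M (\<lambda>x. a * residual M Y Z x) Z" if "IN_condition M Z Y" for a
    using that unfolding IN_condition_def by (rule indep_rv_compose) simp
  then show ?thesis
    using u surrogate unfolding GIN_condition_def IN_condition_def by force
qed

theorem proposition2:
  fixes M :: "'a measure"
    and V :: "'n::finite \<Rightarrow> 'a \<Rightarrow> real"
    and G :: "('n \<times> 'n) set"
    and b :: "'n \<Rightarrow> 'n \<Rightarrow> real"
    and noise :: "'n \<Rightarrow> 'a \<Rightarrow> real"
    and y :: "'n"
    and s :: "'q::finite \<Rightarrow> 'n"
    and Y :: "'a \<Rightarrow> real"
    and Z :: "'a \<Rightarrow> real^'q"
  assumes "lingam M V G b noise"
    and "inj s"
    and "Y = V y"
    and "Z = subvector V s"
  shows "(GIN_condition M Z (prepend Y Z) \<longrightarrow> IN_condition M Z Y) \<and>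
         (IN_condition M Z Y \<longrightarrow> GIN_condition M Z (prepend Y Z))"
proof -
  interpret lingam M V G b noise
    by fact
  show ?thesis
    using GIN_condition_prepend_iff invertible_cross_moment_subvector[OF assms(2)] assms(4)
    by blast
qed

end
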